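(* Let $n\geq 3$ and $2\leq k\leq\binom{n}{2}$, let $p$ be the integer with $k\binom{p}{2}\leq\binom{n}{2}<k\binom{p+1}{2}$, and let $q,r$ be the uniquely determined nonnegative integers with $\binom{n}{2}=k\binom{p}{2}+qp+r$, $0\leq q<k$, $0\leq r<p$. Then $$M(k,n)\leq\begin{cases} kp-k+q & \text{if } r\leq (p-1)/2,\\ kp-k+q+1-\frac{2(p-r)}{p+1} & \text{if } r\geq (p-1)/2.\end{cases}$$ Moreover, equality holds whenever $K_n$ admits an edge decomposition into: $q$ copies of $K_{p+1}$ and $k-q$ copies of $K_p$, if $r=0$; or $q$ copies of $K_{p+1}$, $k-q-1$ copies of $K_p$, and one copy of any one graph $G\in\mathcal{F}_{p,r}$, if $0<r<p$.
   Context: For a finite graph $G$, $\mathrm{Mad}(G)=\max\{2e(H)/|V(H)| : H\subseteq G,\ |V(H)|\geq 1\}$ ($0$ if $G$ has no edges). A $k$-decomposition of $K_n$ is a partition of $E(K_n)$ into $k$ spanning subgraphs $G_1,\dots,G_k$ (edgeless ones allowed); $M(k,n)=\max\sum_{i=1}^k\mathrm{Mad}(G_i)$ over all $k$-decompositions of $K_n$. In an edge decomposition into copies of given graphs, isolated vertices are disregarded. For $p\geq 2$, $0<r<p$ and $m=\binom{p}{2}+r$, the family $\mathcal{F}_{p,r}$ is: the graphs with $m$ edges containing $K_p$ as a subgraph, if $0<r<(p-1)/2$; the graphs with $m$ edges that contain $K_p$ or have exactly $p+1$ vertices, if $r=(p-1)/2$; the graphs with $m$ edges and exactly $p+1$ vertices,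 if $r>(p-1)/2$. *)

theory Defs
  imports Complex_Main
begin

record 'a ugraph =
  verts :: "'a set"
  edges :: "'a set set"

definition finite_graph :: "'a ugraph \<Rightarrow> bool" where
  "finite_graph G \<longleftrightarrow>
     finite (verts G) \<and> edges G \<subseteq> {e. e \<subseteq> verts G \<and> card e = 2}"

definition subgraph :: "'a ugraph \<Rightarrow> 'a ugraph \<Rightarrow> bool" where
  "subgraph H G \<longleftrightarrow> finite_graph H \<and> verts H \<subseteq> verts G \<and> edges H \<subseteq> edges G"

definition graph_iso :: "'a ugraph \<Rightarrow> 'b ugraph \<Rightarrow> bool" where
  "graph_iso G H \<longleftrightarrow>
     (\<exists>f. bij_betw f (verts G) (verts H) \<and> edges H = (\<lambda>e. f ` e) ` edges G)"

definition complete_graph :: "nat \<Rightarrow> nat ugraph" where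
  "complete_graph n = \<lparr>verts = {..<n}, edges = {e. e \<subseteq> {..<n} \<and> card e = 2}\<rparr>"

definition Mad :: "'a ugraph \<Rightarrow> real" where
  "Mad G = (if edges G = {} then 0
            else Max {2 * real (card (edges H)) / real (card (verts H)) | H.
                        subgraph H G \<and> card (verts H) \<ge> 1})"

definition edge_decomposition :: "nat \<Rightarrow> 'a ugraph \<Rightarrow> (nat \<Rightarrow> 'a ugraph) \<Rightarrow> bool" where
  "edge_decomposition k G F \<longleftrightarrow>
     (\<forall>i<k. subgraph (F i) G \<and> verts (F i) = verts G) \<and>
     (\<forall>i<k. \<forall>j<k. i \<noteq> j \<longrightarrow> edges (F i) \<inter> edges (F j) = {}) \<and>
     (\<Union>i<k. edges (F i)) = edges G"

definition M :: "nat \<Rightarrow> nat \<Rightarrow> real" where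
  "M k n = Max {\<Sum>i<k. Mad (F i) | F. edge_decomposition k (complete_graph n) F}"

definition drop_isolated :: "'a ugraph \<Rightarrow> 'a ugraph" where
  "drop_isolated G = G\<lparr>verts := {v \<in> verts G. \<exists>e\<in>edges G. v \<in> e}\<rparr>"

text \<open>
  \<open>Hs\<close> lists the prescribed graphs with multiplicity. The parts of the decomposition are spanning
  subgraphs, so parts and prescribed graphs are compared after deleting isolated vertices.
\<close>
definition decomposes_into :: "'a ugraph \<Rightarrow> 'b ugraph list \<Rightarrow> bool" where
  "decomposes_into G Hs \<longleftrightarrow>
     (\<exists>F. edge_decomposition (length Hs) G F \<and>
          (\<forall>i<length Hs. graph_iso (drop_isolated (F i)) (drop_isolated (Hs ! i))))"

definition contains_clique :: "'a ugraph \<Rightarrow> nat \<Rightarrow> bool" where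
  "contains_clique G p \<longleftrightarrow> (\<exists>H. subgraph H G \<and> graph_iso H (complete_graph p))"

text \<open>
  Finite graphs up to isomorphism: every finite graph has an isomorphic copy with vertices in
  \<^typ>\<open>nat\<close>.
\<close>
definition extremal_family :: "nat \<Rightarrow> nat \<Rightarrow> nat ugraph set" where
  "extremal_family p r =
     {G. finite_graph G \<and> card (edges G) = (p choose 2) + r \<and>
         (if real r < (real p - 1) / 2 then contains_clique G p
          else if real r = (real p - 1) / 2 then contains_clique G p \<or> card (verts G) = p + 1
          else card (verts G) = p + 1)}"

end

theory Submission
  imports Defs "HOL-Library.FuncSet"
begin

text \<open>
  A graph with \<open>m = (p choose 2) + t * p + \<rho>\<close> edges, where \<open>0 \<le> \<rho> < p\<close> and the integer \<open>t\<close> may be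
  negative, satisfies \<open>Mad G \<le> p - 1 + t + \<phi> \<rho>\<close> with \<open>\<phi> \<rho> = max 0 ((2\<rho> - p + 1)/(p + 1))\<close>: a
  subgraph on \<open>h \<le> p + t\<close> vertices has average degree at most \<open>h - 1\<close>, and one on \<open>h \<ge> p + t + 1\<close>
  vertices has average degree at most \<open>2m/(p + t + 1)\<close>. As \<open>\<phi>\<close> is convex with \<open>\<phi> 0 = 0\<close> and
  \<open>\<phi> p = 1\<close>, the function \<open>t * p + \<rho> \<mapsto> t + \<phi> \<rho>\<close> is superadditive on the integers. Summing the
  bounds over the \<open>k\<close> parts therefore gives at most \<open>k * (p - 1) + q + \<phi> r\<close>, and the
  prescribed decompositions attain this value.
\<close>

section \<open>A superadditive staircase function\<close>

text \<open>The argument is an integer because a part may have fewer than \<open>p choose 2\<close>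
  edges; for positive \<open>p\<close> the residue stays in \<open>[0, p)\<close>. Within a period
  the value is flat up to residue \<open>(p - 1)/2\<close> and then climbs with slope
  \<open>2/(p + 1)\<close>, reaching the next integer exactly at residue \<open>p\<close>.\<close>

definition staircase :: "nat \<Rightarrow> int \<Rightarrow> real" where
  "staircase p x =
     of_int (x div int p) +
     max 0 ((2 * of_int (x mod int p) - real p + 1) / (real p + 1))"

lemma staircase_eq:
  assumes "0 \<le> \<rho>" "\<rho> < int p"
  shows "staircase p (t * int p + \<rho>) =
    of_int t + max 0 ((2 * of_int \<rho> - real p + 1) / (real p + 1))"
  using assms by (simp add: staircase_def)

text \<open>The cases are whether the residues carry. Without a carry this is superadditivity of a
  convex function vanishing at 0. With a carry, both residues lie between \<open>R + S - P\<close>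
  and \<open>P\<close>, where convexity applies again.\<close>

lemma staircase_superadditive:
  assumes "p > 0"
  shows "staircase p x + staircase p y \<le> staircase p (x + y)"
proof -
  define t \<rho> u \<sigma> where "t = x div int p" "\<rho> = x mod int p" "u = y div int p" "\<sigma> = y mod int p"
  have x: "x = t * int p + \<rho>" and y: "y = u * int p + \<sigma>"
    by (simp_all add: t_\<rho>_u_\<sigma>_def)
  have bounds: "0 \<le> \<rho>" "\<rho> < int p" "0 \<le> \<sigma>" "\<sigma> < int p"
    using assms by (simp_all add: t_\<rho>_u_\<sigma>_def)
  define R S P where "R = real_of_int \<rho>" "S = real_of_int \<sigma>" "P = real p"
  have R: "0 \<le> R" "0 \<le> S" "R \<le> P - 1" "S \<le> P - 1" "P \<ge> 1"
    using bounds assms by (simp_all add: R_S_P_def)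
  have sx: "staircase p x = of_int t + max 0 ((2 * R - P + 1) / (P + 1))"
    unfolding x R_S_P_def using bounds by (simp add: staircase_eq)
  have sy: "staircase p y = of_int u + max 0 ((2 * S - P + 1) / (P + 1))"
    unfolding y R_S_P_def using bounds by (simp add: staircase_eq)
  show ?thesis
  proof (cases "\<rho> + \<sigma> < int p")
    case True
    have "x + y = (t + u) * int p + (\<rho> + \<sigma>)"
      by (simp add: x y algebra_simps)
    then have "staircase p (x + y) = of_int (t + u) + max 0 ((2 * (R + S) - P + 1) / (P + 1))"
      using True bounds by (simp add: staircase_eq R_S_P_def)
    moreover have "max 0 ((2 * R - P + 1) / (P + 1)) + max 0 ((2 * S - P + 1) / (P + 1))
        \<le> max 0 ((2 * (R + S) - P + 1) / (P + 1))"
      using R by (auto simp: max_def divide_simps)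
    ultimately show ?thesis
      by (simp add: sx sy)
  next
    case False
    have "x + y = (t + u + 1) * int p + (\<rho> + \<sigma> - int p)"
      by (simp add: x y algebra_simps)
    then have "staircase p (x + y) =
        of_int (t + u + 1) + max 0 ((2 * (R + S - P) - P + 1) / (P + 1))"
      using False bounds staircase_eq[of "\<rho> + \<sigma> - int p" p "t + u + 1"]
      by (simp add: R_S_P_def)
    \<comment> \<open>If both maxima on the left are attained by the fractions, the left side equals
      the right side with its maximum replaced by the fraction; otherwise the left side is at most
      1, since residues are below \<open>P\<close>.\<close>
    moreover have "max 0 ((2 * R - P + 1) / (P + 1)) + max 0 ((2 * S - P + 1) / (P + 1))
        \<le> 1 + max 0 ((2 * (R + S - P) - P + 1) / (P + 1))"
      using R by (auto simp: max_def divide_simps)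
    ultimately show ?thesis
      by (simp add: sx sy)
  qed
qed

lemma sum_staircase_le:
  assumes "p > 0" "finite A"
  shows "(\<Sum>i\<in>A. staircase p (x i)) \<le> staircase p (\<Sum>i\<in>A. x i)"
  using assms(2)
proof (induction A rule: finite_induct)
  case empty
  then show ?case by (simp add: staircase_def)
next
  case (insert a A)
  then show ?case
    using staircase_superadditive[OF assms(1), of "x a" "\<Sum>i\<in>A. x i"] by simp
qed

section \<open>Average degree in terms of the number of edges\<close>

lemma real_choose_two: "real (n choose 2) = real n * (real n - 1) / 2"
  by (induction n) (simp_all add: numeral_2_eq_2 field_simps)

text \<open>The arithmetic core of the bound on \<open>Mad\<close>: \<open>h\<close> stands for the
  order of a subgraph of a graph with \<open>m\<close> edges, and \<open>min\<close> keeps both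
  available bounds on its size. The threshold \<open>p + t\<close> decides which of the two is
  used.\<close>

lemma average_degree_le_staircase:
  fixes h m p :: nat
  assumes "p > 0" "h > 0"
  shows "2 * real (min m (h choose 2)) / real h
    \<le> real p - 1 + staircase p (int m - int (p choose 2))"
proof -
  define t \<rho> where "t = (int m - int (p choose 2)) div int p" "\<rho> = (int m - int (p choose 2)) mod int p"
  have m_int: "int m = int (p choose 2) + t * int p + \<rho>"
    by (simp add: t_\<rho>_def)
  have bounds: "0 \<le> \<rho>" "\<rho> < int p"
    using assms by (simp_all add: t_\<rho>_def)
  define y where "y = max 0 ((2 * of_int \<rho> - real p + 1) / (real p + 1))"
  have stair: "staircase p (int m - int (p choose 2)) = of_int t + y"
    by (simp add: staircase_def t_\<rho>_def y_def)
  have y: "0 \<le> y" "y \<le> 1"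
    using bounds assms by (simp_all add: y_def divide_simps)
  have y_ge: "2 * of_int \<rho> - real p + 1 \<le> (real p + 1) * y"
  proof -
    have "(2 * of_int \<rho> - real p + 1) / (real p + 1) \<le> y"
      by (simp add: y_def)
    then show ?thesis
      by (simp add: pos_divide_le_eq mult.commute)
  qed
  have m: "2 * real m = real p * (real p - 1) + 2 * of_int t * real p + 2 * of_int \<rho>"
  proof -
    have "real m = real (p choose 2) + of_int t * real p + of_int \<rho>"
      using arg_cong[OF m_int, of real_of_int] by simp
    then show ?thesis
      by (simp add: real_choose_two field_simps)
  qed
  show ?thesis
  proof (cases "int h \<le> int p + t")
    case True
    then have "real h \<le> real p + of_int t"
      by linarith
    moreover have "2 * real (min m (h choose 2)) / real h \<le> 2 * real (h choose 2) / real h"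
      by (intro divide_right_mono) auto
    moreover have "2 * real (h choose 2) / real h = real h - 1"
      using assms by (simp add: real_choose_two)
    ultimately show ?thesis
      using y by (simp add: stair)
  next
    case False
    define w where "w = real p + of_int t + 1"
    \<comment> \<open>Otherwise \<open>t \<le> - p - 1\<close>, and the formula for
      \<open>2 * real m\<close> would make the number of edges negative.\<close>
    have "w > 0"
    proof (rule ccontr)
      assume "\<not> w > 0"
      then have "of_int t \<le> - real p - 1"
        by (simp add: w_def)
      then have "of_int t * real p \<le> (- real p - 1) * real p"
        by (intro mult_right_mono) auto
      moreover have "of_int \<rho> \<le> real p"
        using bounds by linarith
      moreover have "real p * real p > 0"
        using assms by simp
      ultimately show False
        using m unfolding left_diff_distrib right_diff_distrib by linarith
    qed
    have "w \<le> real h"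
      using False by (simp add: w_def)
    have "2 * real (min m (h choose 2)) / real h \<le> 2 * real m / w"
      using \<open>w > 0\<close> \<open>w \<le> real h\<close> by (intro frac_le) auto
    also have "\<dots> \<le> real p - 1 + (of_int t + y)"
    proof -
      \<comment> \<open>Integrality of \<open>t\<close> enters here: \<open>t * (t + y)\<close> is
        negative only for \<open>t\<close> strictly between \<open>-y\<close> and 0, and as
        \<open>y \<le> 1\<close> no integer lies there.\<close>
      have sq: "0 \<le> real_of_int t * of_int t + of_int t * y"
      proof (cases "t \<ge> 0")
        case True
        then show ?thesis using y by simp
      next
        case False
        then have "real_of_int t \<le> - 1"
          by linarith
        then have "0 \<le> (- real_of_int t) * (- of_int t - y)"
          using y by (intro mult_nonneg_nonneg) auto
        then show ?thesis
          by (simp add: algebra_simps)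
      qed
      \<comment> \<open>After clearing the denominator, the slack is exactly the sum of the two
        quantities shown nonnegative in \<open>sq\<close> and \<open>y_ge\<close>.\<close>
      have "(real p - 1 + (of_int t + y)) * w - 2 * real m
          = (of_int t * of_int t + of_int t * y)
            + ((real p + 1) * y - (2 * of_int \<rho> - real p + 1))"
        unfolding m w_def by (simp add: algebra_simps)
      then have "2 * real m \<le> (real p - 1 + (of_int t + y)) * w"
        using sq y_ge by linarith
      then show ?thesis
        using \<open>w > 0\<close> by (simp add: pos_divide_le_eq)
    qed
    finally show ?thesis
      by (simp add: stair)
  qed
qed

section \<open>Bounds on the maximum average degree\<close>

lemma finite_edges:
  assumes "finite_graph G"
  shows "finite (edges G)"
  using assms unfolding finite_graph_def
  by (auto intro: finite_subset[of _ "Pow (verts G)"])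

lemma card_edges_le:
  assumes "finite_graph G"
  shows "card (edges G) \<le> card (verts G) choose 2"
proof -
  have fin: "finite (verts G)"
    using assms by (simp add: finite_graph_def)
  have "card (edges G) \<le> card {e. e \<subseteq> verts G \<and> card e = 2}"
    using assms fin by (intro card_mono) (auto simp: finite_graph_def)
  then show ?thesis
    using n_subsets[OF fin] by simp
qed

text \<open>Each value depends only on two bounded counts. Finiteness gives \<open>Max\<close> in
  \<open>Mad\<close> its intended meaning.\<close>

lemma finite_average_degrees:
  assumes "finite_graph G"
  shows "finite {2 * real (card (edges H)) / real (card (verts H)) | H.
    subgraph H G \<and> card (verts H) \<ge> 1}" (is "finite ?D")
proof -
  have "?D \<subseteq> (\<lambda>(e, v). 2 * real e / real v) ` ({..card (edges G)} \<times> {..card (verts G)})"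
  proof
    fix d assume "d \<in> ?D"
    then obtain H where H: "subgraph H G"
      and d: "d = 2 * real (card (edges H)) / real (card (verts H))"
      by blast
    have "card (edges H) \<le> card (edges G)" "card (verts H) \<le> card (verts G)"
      using H assms finite_edges[OF assms]
      by (auto simp: subgraph_def finite_graph_def intro: card_mono)
    then show "d \<in> (\<lambda>(e, v). 2 * real e / real v) ` ({..card (edges G)} \<times> {..card (verts G)})"
      unfolding d by force
  qed
  then show ?thesis
    by (rule finite_subset) simp
qed

lemma average_degree_le_Mad:
  assumes "finite_graph G" "subgraph H G" "card (verts H) \<ge> 1"
  shows "2 * real (card (edges H)) / real (card (verts H)) \<le> Mad G"
proof (cases "edges G = {}")
  case True
  then have "edges H = {}"
    using assms(2) by (auto simp: subgraph_def)
  then show ?thesis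
    using True by (simp add: Mad_def)
next
  case False
  then show ?thesis
    using assms finite_average_degrees[OF assms(1)]
    by (auto simp: Mad_def intro!: Max_ge)
qed

lemma Mad_nonneg:
  assumes "finite_graph G"
  shows "0 \<le> Mad G"
proof (cases "edges G = {}")
  case True
  then show ?thesis by (simp add: Mad_def)
next
  case False
  then have "verts G \<noteq> {}"
    using assms by (force simp: finite_graph_def)
  then have "card (verts G) \<ge> 1"
    using assms by (simp add: finite_graph_def Suc_leI card_gt_0_iff)
  moreover have "subgraph G G"
    using assms by (simp add: subgraph_def)
  ultimately have "2 * real (card (edges G)) / real (card (verts G)) \<le> Mad G"
    using assms by (intro average_degree_le_Mad)
  then show ?thesis
    by (rule order_trans[rotated]) simp
qed

lemma Mad_le_staircase:
  assumes "finite_graph G" "p > 0"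
  shows "Mad G \<le> real p - 1 + staircase p (int (card (edges G)) - int (p choose 2))"
proof (cases "edges G = {}")
  case True
  \<comment> \<open>\<open>Mad\<close> is 0 by convention here; a single vertex without edges
    supplies the matching instance.\<close>
  then show ?thesis
    using average_degree_le_staircase[OF assms(2), of 1 0] by (simp add: Mad_def)
next
  case False
  let ?D = "{2 * real (card (edges H)) / real (card (verts H)) | H.
    subgraph H G \<and> card (verts H) \<ge> 1}"
  have "verts G \<noteq> {}"
    using assms False by (force simp: finite_graph_def)
  then have "card (verts G) \<ge> 1"
    using assms by (simp add: finite_graph_def Suc_leI card_gt_0_iff)
  moreover have "subgraph G G"
    using assms by (simp add: subgraph_def)
  ultimately have "?D \<noteq> {}"
    by blast
  moreover have "d \<le> real p - 1 + staircase p (int (card (edges G)) - int (p choose 2))"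
    if "d \<in> ?D" for d
  proof -
    from that obtain H where H: "subgraph H G" "card (verts H) \<ge> 1"
      and d: "d = 2 * real (card (edges H)) / real (card (verts H))"
      by blast
    have "card (edges H) \<le> min (card (edges G)) (card (verts H) choose 2)"
      using H finite_edges[OF assms(1)] card_edges_le[of H]
      by (auto simp: subgraph_def intro: card_mono)
    then have "d \<le> 2 * real (min (card (edges G)) (card (verts H) choose 2)) / real (card (verts H))"
      unfolding d by (intro divide_right_mono mult_left_mono of_nat_mono) auto
    also have "\<dots> \<le> real p - 1 + staircase p (int (card (edges G)) - int (p choose 2))"
      using assms H by (intro average_degree_le_staircase) auto
    finally show ?thesis .
  qed
  ultimately show ?thesis
    using False finite_average_degrees[OF assms(1)] by (simp add: Mad_def)
qed

section \<open>Isomorphic copies and lower bounds on \<open>Mad\<close>\<close>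

lemma card_edges_iso:
  assumes "finite_graph G" "graph_iso G H"
  shows "card (edges H) = card (edges G)"
proof -
  obtain f where f: "bij_betw f (verts G) (verts H)" "edges H = (\<lambda>e. f ` e) ` edges G"
    using assms by (auto simp: graph_iso_def)
  have "inj_on (\<lambda>e. f ` e) (edges G)"
    using assms(1) inj_on_image_eq_iff[OF bij_betw_imp_inj_on[OF f(1)]]
    by (intro inj_onI) (auto simp: finite_graph_def subset_iff)
  then show ?thesis
    by (simp add: f card_image)
qed

lemma card_verts_iso: "graph_iso G H \<Longrightarrow> card (verts H) = card (verts G)"
  by (auto simp: graph_iso_def dest: bij_betw_same_card)

text \<open>
  Only the vertices of \<open>H\<close> that lie on an edge can be carried over to \<open>G\<close>; discarding the others
  does not decrease the average degree.
\<close>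
lemma average_degree_le_Mad_iso:
  assumes "finite_graph G" "finite_graph G'"
    and iso: "graph_iso (drop_isolated G) (drop_isolated G')"
    and "subgraph H G'" "card (verts H) \<ge> 1"
  shows "2 * real (card (edges H)) / real (card (verts H)) \<le> Mad G"
proof (cases "edges H = {}")
  case True
  then show ?thesis
    using Mad_nonneg[OF assms(1)] by simp
next
  case False
  let ?V = "verts (drop_isolated G)"
  obtain f where f: "bij_betw f ?V (verts (drop_isolated G'))"
      "edges G' = (\<lambda>e. f ` e) ` edges G"
    using iso by (auto simp: graph_iso_def drop_isolated_def)
  have edge: "e \<subseteq> ?V" "card e = 2" if "e \<in> edges G" for e
    using that assms(1) by (auto simp: finite_graph_def drop_isolated_def)
  \<comment> \<open>\<open>E\<close> pulls the edges of \<open>H\<close> back to \<open>G\<close>.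
    With \<open>\<Union>E\<close> as vertex set, \<open>K\<close> has no isolated vertices, so
    \<open>f\<close> is injective on all of it and maps it into \<open>verts H\<close>.\<close>
  define E where "E = {e \<in> edges G. f ` e \<in> edges H}"
  define K where "K = \<lparr>verts = \<Union>E, edges = E\<rparr>"
  have fE: "(\<lambda>e. f ` e) ` E = edges H"
    using f(2) assms(4) by (auto simp: E_def subgraph_def)
  have injV: "inj_on f ?V"
    using f(1) by (rule bij_betw_imp_inj_on)
  have "inj_on (\<lambda>e. f ` e) E"
    using edge injV by (intro inj_onI) (auto simp: E_def inj_on_image_eq_iff)
  then have cardE: "card (edges H) = card E"
    using card_image fE by metis
  have EV: "\<Union>E \<subseteq> ?V" "\<Union>E \<subseteq> verts G"
    using edge by (auto simp: E_def drop_isolated_def)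
  have finV: "finite (\<Union>E)"
    using EV(2) assms(1) by (auto simp: finite_graph_def intro: finite_subset)
  have "f ` \<Union>E \<subseteq> verts H"
    using assms(4) by (auto simp: E_def subgraph_def finite_graph_def)
  moreover have "inj_on f (\<Union>E)"
    using injV EV(1) by (rule inj_on_subset)
  ultimately have cardV: "card (\<Union>E) \<le> card (verts H)"
    using assms(4) by (intro card_inj_on_le) (auto simp: subgraph_def finite_graph_def)
  have K: "subgraph K G"
    using EV(2) finV edge by (auto simp: K_def subgraph_def finite_graph_def E_def)
  have "E \<noteq> {}"
    using False fE by auto
  then obtain e where "e \<in> E"
    by blast
  then have "e \<noteq> {}" "e \<subseteq> \<Union>E"
    using edge(2)[of e] by (auto simp: E_def)
  then have cardV1: "card (\<Union>E) \<ge> 1"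
    using finV by (metis One_nat_def Suc_leI card_gt_0_iff subset_empty)
  have "2 * real (card (edges H)) / real (card (verts H)) \<le> 2 * real (card E) / real (card (\<Union>E))"
    using cardE cardV cardV1 by (intro frac_le) auto
  also have "\<dots> \<le> Mad G"
    using average_degree_le_Mad[OF assms(1) K] cardV1 by (simp add: K_def)
  finally show ?thesis .
qed

lemma finite_graph_complete: "finite_graph (complete_graph n)"
  by (simp add: finite_graph_def complete_graph_def)

lemma card_edges_complete: "card (edges (complete_graph n)) = n choose 2"
  using n_subsets[of "{..<n}" 2] by (simp add: complete_graph_def)

lemma card_verts_complete: "card (verts (complete_graph n)) = n"
  by (simp add: complete_graph_def)

lemma Mad_ge_contains_clique:
  assumes "finite_graph G" "finite_graph G'"
    and "graph_iso (drop_isolated G) (drop_isolated G')"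
    and "contains_clique G' p" "p > 0"
  shows "real p - 1 \<le> Mad G"
proof -
  obtain H where H: "subgraph H G'" "graph_iso H (complete_graph p)"
    using assms(4) by (auto simp: contains_clique_def)
  have "card (verts H) = p" "card (edges H) = p choose 2"
    using card_verts_iso[OF H(2)] card_edges_iso[OF _ H(2)] H(1)
    by (simp_all add: card_verts_complete card_edges_complete subgraph_def)
  then show ?thesis
    using average_degree_le_Mad_iso[OF assms(1-3) H(1)] assms(5)
    by (simp add: real_choose_two)
qed

lemma contains_clique_complete: "contains_clique (complete_graph p) p"
proof -
  have "graph_iso (complete_graph p) (complete_graph p)"
    unfolding graph_iso_def by (rule exI[of _ id]) simp
  then show ?thesis
    using finite_graph_complete by (auto simp: contains_clique_def subgraph_def)
qed

text \<open>A \<open>p\<close>-clique yields \<open>p - 1\<close>, while a graph on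
  \<open>p + 1\<close> vertices is itself a subgraph of average degree \<open>2m/(p + 1)\<close>.
  The case distinction defining the family selects the larger of these two values.\<close>

lemma Mad_ge_extremal_family:
  assumes "finite_graph G" "G' \<in> extremal_family p r"
    and "graph_iso (drop_isolated G) (drop_isolated G')" and "p > 0"
  shows "real p - 1 + max 0 ((2 * real r - real p + 1) / (real p + 1)) \<le> Mad G"
proof -
  have G': "finite_graph G'" "card (edges G') = (p choose 2) + r"
    using assms(2) by (simp_all add: extremal_family_def)
  have clique: "real p - 1 \<le> Mad G" if "contains_clique G' p"
    using Mad_ge_contains_clique[OF assms(1) G'(1) assms(3) that assms(4)] .
  have spread: "real p - 1 + (2 * real r - real p + 1) / (real p + 1) \<le> Mad G"
    if "card (verts G') = p + 1"
  proof -
    have "2 * real (card (edges G')) / real (card (verts G')) \<le> Mad G"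
      using that G' assms by (intro average_degree_le_Mad_iso) (auto simp: subgraph_def)
    moreover have "2 * real (card (edges G')) / real (card (verts G'))
        = real p - 1 + (2 * real r - real p + 1) / (real p + 1)"
      using that G' by (simp add: real_choose_two field_simps)
    ultimately show ?thesis by simp
  qed
  consider "real r < (real p - 1) / 2" "contains_clique G' p"
    | "real r = (real p - 1) / 2" "contains_clique G' p \<or> card (verts G') = p + 1"
    | "real r > (real p - 1) / 2" "card (verts G') = p + 1"
    using assms(2) by (force simp: extremal_family_def split: if_splits)
  then show ?thesis
  proof cases
    case 1
    then show ?thesis using clique by (simp add: max_def divide_simps)
  next
    case 2
    \<comment> \<open>At the threshold both values coincide, so either alternative suffices.\<close>
    then have zero: "(2 * real r - real p + 1) / (real p + 1) = 0" by simp
    show ?thesis using 2(2) clique spread unfolding zero by auto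
  next
    case 3
    then show ?thesis using spread by (simp add: max_def divide_simps)
  qed
qed

section \<open>Decompositions of the complete graph\<close>

text \<open>There are infinitely many \<open>F\<close>, as its values from index \<open>k\<close> on
  are arbitrary; restricting to \<open>{..<k}\<close> leaves finitely many functions and the same
  sums.\<close>

lemma finite_decomposition_values:
  assumes "finite_graph G"
  shows "finite {\<Sum>i<k. Mad (F i) | F. edge_decomposition k G F}" (is "finite ?S")
proof -
  let ?P = "(\<lambda>E. \<lparr>verts = verts G, edges = E\<rparr>) ` Pow (edges G)"
  have "?S \<subseteq> (\<lambda>F. \<Sum>i<k. Mad (F i)) ` (\<Pi>\<^sub>E i\<in>{..<k}. ?P)"
  proof
    fix s assume "s \<in> ?S"
    then obtain F where F: "edge_decomposition k G F" and s: "s = (\<Sum>i<k. Mad (F i))"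
      by blast
    have "F i \<in> ?P" if "i < k" for i
    proof -
      have "F i = \<lparr>verts = verts G, edges = edges (F i)\<rparr>" "edges (F i) \<subseteq> edges G"
        using F that by (auto simp: edge_decomposition_def subgraph_def)
      then show ?thesis by blast
    qed
    then have "restrict F {..<k} \<in> (\<Pi>\<^sub>E i\<in>{..<k}. ?P)"
      by (intro restrict_PiE_iff[THEN iffD2]) auto
    moreover have "s = (\<Sum>i<k. Mad (restrict F {..<k} i))"
      by (simp add: s)
    ultimately show "s \<in> (\<lambda>F. \<Sum>i<k. Mad (F i)) ` (\<Pi>\<^sub>E i\<in>{..<k}. ?P)"
      by blast
  qed
  moreover have "finite (\<Pi>\<^sub>E i\<in>{..<k}. ?P)"
    using finite_edges[OF assms] by (intro finite_PiE) auto
  ultimately show ?thesis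
    by (meson finite_imageI finite_subset)
qed

text \<open>One part takes all edges, so the set under \<open>Max\<close> in \<open>M\<close> is
  nonempty.\<close>

lemma ex_edge_decomposition:
  assumes "finite_graph G" "k > 0"
  shows "\<exists>F. edge_decomposition k G F"
proof
  show "edge_decomposition k G
      (\<lambda>i. \<lparr>verts = verts G, edges = if i = 0 then edges G else {}\<rparr>)"
    using assms
    by (auto simp: edge_decomposition_def subgraph_def finite_graph_def split: if_splits)
qed

lemma sum_Mad_le_M:
  assumes "edge_decomposition k (complete_graph n) F"
  shows "(\<Sum>i<k. Mad (F i)) \<le> M k n"
  unfolding M_def
  using assms finite_decomposition_values[OF finite_graph_complete] by (intro Max_ge) auto

lemma sum_card_edges:
  assumes "finite_graph G" "edge_decomposition k G F"
  shows "(\<Sum>i<k. card (edges (F i))) = card (edges G)"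
proof -
  have "card (\<Union>i<k. edges (F i)) = (\<Sum>i<k. card (edges (F i)))"
    using assms by (intro card_UN_disjoint)
      (auto simp: edge_decomposition_def subgraph_def intro: finite_edges)
  then show ?thesis
    using assms(2) by (simp add: edge_decomposition_def)
qed

text \<open>The excesses of the parts over \<open>p choose 2\<close> edges have a sum independent of
  the decomposition, so superadditivity turns the bounds on the parts into one bound for all
  decompositions.\<close>

lemma M_le_staircase:
  assumes "k > 0" "p > 0"
  shows "M k n \<le> real k * (real p - 1)
    + staircase p (int (n choose 2) - int k * int (p choose 2))"
proof -
  have "(\<Sum>i<k. Mad (F i)) \<le> real k * (real p - 1)
      + staircase p (int (n choose 2) - int k * int (p choose 2))"
    if F: "edge_decomposition k (complete_graph n) F" for F
  proof -
    have "(\<Sum>i<k. Mad (F i))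
        \<le> (\<Sum>i<k. real p - 1 + staircase p (int (card (edges (F i))) - int (p choose 2)))"
      using F assms by (intro sum_mono Mad_le_staircase)
        (auto simp: edge_decomposition_def subgraph_def)
    also have "\<dots> = real k * (real p - 1)
        + (\<Sum>i<k. staircase p (int (card (edges (F i))) - int (p choose 2)))"
      by (simp add: sum.distrib)
    also have "(\<Sum>i<k. staircase p (int (card (edges (F i))) - int (p choose 2)))
        \<le> staircase p (\<Sum>i<k. int (card (edges (F i))) - int (p choose 2))"
      using assms by (intro sum_staircase_le) auto
    also have "(\<Sum>i<k. int (card (edges (F i))) - int (p choose 2))
        = int (n choose 2) - int k * int (p choose 2)"
      using sum_card_edges[OF finite_graph_complete F]
      by (simp add: sum_subtractf card_edges_complete flip: of_nat_sum)
    finally show ?thesis by simp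
  qed
  then show ?thesis
    unfolding M_def
    using finite_decomposition_values[OF finite_graph_complete]
      ex_edge_decomposition[OF finite_graph_complete assms(1)]
    by (subst Max_le_iff) auto
qed

text \<open>\<open>ds\<close> lists lower bounds parallel to \<open>Hs\<close>. They are required
  for every copy of the prescribed graph, up to isolated vertices, because the decomposition only
  guarantees some such copy.\<close>

lemma M_ge_sum_list:
  assumes "decomposes_into (complete_graph n) Hs" "length Hs = k" "length ds = k"
    and bound: "\<And>G i. i < k \<Longrightarrow> finite_graph G \<Longrightarrow>
      graph_iso (drop_isolated G) (drop_isolated (Hs ! i)) \<Longrightarrow> ds ! i \<le> Mad (G :: nat ugraph)"
  shows "sum_list ds \<le> M k n"
proof -
  obtain F where F: "edge_decomposition k (complete_graph n) F"
      "\<And>i. i < k \<Longrightarrow> graph_iso (drop_isolated (F i)) (drop_isolated (Hs ! i))"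
    using assms(1,2) by (auto simp: decomposes_into_def)
  have "sum_list ds = (\<Sum>i<k. ds ! i)"
    using assms(3) by (simp add: sum_list_sum_nth atLeast0LessThan)
  also have "\<dots> \<le> (\<Sum>i<k. Mad (F i))"
    using F by (intro sum_mono bound) (auto simp: edge_decomposition_def subgraph_def)
  also have "\<dots> \<le> M k n"
    using F(1) by (rule sum_Mad_le_M)
  finally show ?thesis .
qed

theorem theorem5p2:
  fixes n k p q r :: nat
  assumes "n \<ge> 3"
    and "2 \<le> k" and "k \<le> n choose 2"
    and "k * (p choose 2) \<le> n choose 2" and "n choose 2 < k * ((p + 1) choose 2)"
    and "n choose 2 = k * (p choose 2) + q * p + r"
    and "q < k" and "r < p"
  shows
    "(real r \<le> (real p - 1) / 2 \<longrightarrow>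
        M k n \<le> real k * real p - real k + real q) \<and>
     (real r \<ge> (real p - 1) / 2 \<longrightarrow>
        M k n \<le> real k * real p - real k + real q + 1 - 2 * (real p - real r) / (real p + 1)) \<and>
     ((r = 0 \<and>
         decomposes_into (complete_graph n)
           (replicate q (complete_graph (p + 1)) @ replicate (k - q) (complete_graph p))
       \<or> 0 < r \<and>
         (\<exists>G \<in> extremal_family p r.
           decomposes_into (complete_graph n)
             (replicate q (complete_graph (p + 1)) @ replicate (k - q - 1) (complete_graph p) @ [G])))
      \<longrightarrow>
        (real r \<le> (real p - 1) / 2 \<longrightarrow>
           M k n = real k * real p - real k + real q) \<and>
        (real r \<ge> (real p - 1) / 2 \<longrightarrow>
           M k n = real k * real p - real k + real q + 1 - 2 * (real p - real r) / (real p + 1)))"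
proof -
  \<comment> \<open>The part of \<open>staircase p (q * p + r)\<close> above \<open>q\<close>; it
    merges the two cases of the bound.\<close>
  define \<phi> where "\<phi> = max 0 ((2 * real r - real p + 1) / (real p + 1))"
  have "p > 1"
  proof (rule ccontr)
    assume "\<not> p > 1"
    \<comment> \<open>For \<open>p = 1\<close> the upper estimate in the choice of \<open>p\<close>
      reads \<open>n choose 2 < k\<close>, against \<open>k \<le> n choose 2\<close>.\<close>
    then have "p = 1"
      using assms(8) by simp
    then show False
      using assms(3,5) by (simp add: numeral_2_eq_2)
  qed
  have \<phi>_low: "\<phi> = 0" if "real r \<le> (real p - 1) / 2"
    using that by (simp add: \<phi>_def max_def divide_simps)
  have \<phi>_high: "\<phi> = 1 - 2 * (real p - real r) / (real p + 1)" if "real r \<ge> (real p - 1) / 2"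
    using that by (simp add: \<phi>_def max_def field_simps)
  have "int (n choose 2) - int k * int (p choose 2) = int q * int p + int r"
    unfolding assms(6) by simp
  then have upper: "M k n \<le> real k * (real p - 1) + real q + \<phi>"
    using M_le_staircase[of k p n] staircase_eq[of "int r" p "int q"] assms \<open>p > 1\<close>
    by (simp add: \<phi>_def)
  have complete: "real m - 1 \<le> Mad G"
    if "finite_graph G" "graph_iso (drop_isolated G) (drop_isolated (complete_graph m))" "m > 0"
    for G :: "nat ugraph" and m
    using Mad_ge_contains_clique[OF that(1) finite_graph_complete that(2) contains_clique_complete that(3)] .
  have lower: "real k * (real p - 1) + real q + \<phi> \<le> M k n"
    if "r = 0" "decomposes_into (complete_graph n)
      (replicate q (complete_graph (p + 1)) @ replicate (k - q) (complete_graph p))"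
  proof -
    \<comment> \<open>The total is
      \<open>q * p + (k - q) * (p - 1) = k * (p - 1) + q\<close>.\<close>
    have "sum_list (replicate q (real (p + 1) - 1) @ replicate (k - q) (real p - 1)) \<le> M k n"
    proof (rule M_ge_sum_list[OF that(2)])
      fix G :: "nat ugraph" and i
      assume "i < k" "finite_graph G"
        and "graph_iso (drop_isolated G) (drop_isolated
          ((replicate q (complete_graph (p + 1)) @ replicate (k - q) (complete_graph p)) ! i))"
      then show "(replicate q (real (p + 1) - 1) @ replicate (k - q) (real p - 1)) ! i \<le> Mad G"
        using complete[of G "p + 1"] complete[of G p] \<open>p > 1\<close>
        by (cases "i < q") (auto simp: nth_append)
    qed (use assms(7) in auto)
    moreover have "\<phi> = 0"
      using that(1) \<open>p > 1\<close> by (intro \<phi>_low) simp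
    ultimately show ?thesis
      using assms(7) by (simp add: sum_list_replicate of_nat_diff algebra_simps)
  qed
  have lower': "real k * (real p - 1) + real q + \<phi> \<le> M k n"
    if "G' \<in> extremal_family p r" "decomposes_into (complete_graph n)
      (replicate q (complete_graph (p + 1)) @ replicate (k - q - 1) (complete_graph p) @ [G'])"
    for G'
  proof -
    have "sum_list (replicate q (real (p + 1) - 1) @ replicate (k - q - 1) (real p - 1)
        @ [real p - 1 + \<phi>]) \<le> M k n"
    proof (rule M_ge_sum_list[OF that(2)])
      fix G :: "nat ugraph" and i
      assume i: "i < k" and G: "finite_graph G"
        and iso: "graph_iso (drop_isolated G) (drop_isolated ((replicate q (complete_graph (p + 1))
          @ replicate (k - q - 1) (complete_graph p) @ [G']) ! i))"
      \<comment> \<open>The three blocks of the list: since \<open>q < k\<close>, the graph from the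
        family sits at index \<open>k - 1\<close>, and the middle block is empty when
        \<open>q = k - 1\<close>.\<close>
      consider "i < q" | "q \<le> i" "i < k - 1" | "i = k - 1"
        using i by linarith
      then show "(replicate q (real (p + 1) - 1) @ replicate (k - q - 1) (real p - 1)
        @ [real p - 1 + \<phi>]) ! i \<le> Mad G"
      proof cases
        case 1
        then show ?thesis
          using iso complete[OF G, of "p + 1"] by (simp add: nth_append)
      next
        case 2
        then have "i - q < k - q - 1" by linarith
        then show ?thesis
          using 2 iso complete[OF G, of p] \<open>p > 1\<close> by (simp add: nth_append)
      next
        case 3
        then have "\<not> k - 1 < q"
          using assms(7) by linarith
        with 3 show ?thesis
          using iso Mad_ge_extremal_family[OF G that(1)] \<open>p > 1\<close> assms(7)
          by (simp add: nth_append \<phi>_def)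
      qed
    qed (use assms(7) in auto)
    then show ?thesis
      using assms(7) by (simp add: sum_list_replicate of_nat_diff algebra_simps)
  qed
  have eq: "M k n = real k * real p - real k + real q + \<phi>"
    if "r = 0 \<and> decomposes_into (complete_graph n)
           (replicate q (complete_graph (p + 1)) @ replicate (k - q) (complete_graph p))
       \<or> 0 < r \<and> (\<exists>G \<in> extremal_family p r. decomposes_into (complete_graph n)
             (replicate q (complete_graph (p + 1)) @ replicate (k - q - 1) (complete_graph p) @ [G]))"
  proof -
    have "real k * (real p - 1) + real q + \<phi> \<le> M k n"
      using that lower lower' by blast
    then show ?thesis
      using upper by (simp add: algebra_simps)
  qed
  show ?thesis
  proof (intro conjI impI)
    show "M k n \<le> real k * real p - real k + real q" if "real r \<le> (real p - 1) / 2"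
      using upper \<phi>_low[OF that] by (simp add: algebra_simps)
    show "M k n \<le> real k * real p - real k + real q + 1 - 2 * (real p - real r) / (real p + 1)"
      if "real r \<ge> (real p - 1) / 2"
    proof -
      have "M k n \<le> real k * real p - real k + real q + \<phi>"
        using upper by (simp add: algebra_simps)
      then show ?thesis
        using \<phi>_high[OF that] by linarith
    qed
  qed (use eq \<phi>_low \<phi>_high in linarith)+
qed

end
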